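(* Let $G$ be a locally compact group and let $A$ be a commutative unital dual Banach algebra. Then $M(G,A)=L^{1}(G,A)$ if and only if $G$ is discrete.
   Context: Dual Banach algebra: a Banach algebra $A$ for which there is a Banach space $E$ with $A=E^{*}$ and multiplication separately weak*-continuous. $M(G,A)$ is the space of bounded regular vector measures $\mu:\mathcal{B}(G)\to A$, where $\mathcal{B}(G)$ is the Borel $\sigma$-algebra of $G$. A vector measure is a $\sigma$-additive map $\mu:\mathcal B(G)\to A$. It is regular if for every $E\in\mathcal B(G)$ and $\epsilon>0$ there are a compact $K$ and an open $U$ with $K\subseteq E\subseteq U$ and $\|\mu(F)\|<\epsilon$ for every Borel $F\subseteq U\setminus K$. It is bounded if its total variation $\|\mu\|=|\mu|(G)$ is finite, where $|\mu|(E)=\sup\{\sum_{i=1}^n\|\mu(E_i)\|:\{E_i\}_{i=1}^n\text{ a finite Borel partition of }E\}$. $L^{1}(G,A)$: (a.e. classes of) Bochner measurable $f:G\to A$ with $\int_G\|f(x)\|_A\,dx<\infty$ (Haar measure), so that $L^1(G,A)\cong L^1(G)\hat\otimes A$. It is regarded as a subspace of $M(G,A)$ by identifying $f$ with the vector measure $E\mapsto\int_E f(x)\,dx$; the equality $M(G,A)=L^1(G,A)$ means that this embedding is onto. *)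

theory Defs
  imports "HOL-Analysis.Analysis"
begin

section \<open>Complex Banach spaces and Banach algebras\<close>

class complex_banach = banach +
  fixes scaleC :: "complex \<Rightarrow> 'a \<Rightarrow> 'a"  (infixr "*\<^sub>C" 75)
  assumes scaleC_add_right: "c *\<^sub>C (x + y) = c *\<^sub>C x + c *\<^sub>C y"
    and scaleC_add_left: "(c + d) *\<^sub>C x = c *\<^sub>C x + d *\<^sub>C x"
    and scaleC_scaleC: "c *\<^sub>C d *\<^sub>C x = (c * d) *\<^sub>C x"
    and scaleR_eq_scaleC: "r *\<^sub>R x = complex_of_real r *\<^sub>C x"
    and norm_scaleC: "norm (c *\<^sub>C x) = cmod c * norm x"

class complex_banach_algebra = complex_banach + real_normed_algebra +
  assumes mult_scaleC_left: "(c *\<^sub>C x) * y = c *\<^sub>C (x * y)"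
    and mult_scaleC_right: "x * (c *\<^sub>C y) = c *\<^sub>C (x * y)"

instantiation complex :: complex_banach_algebra
begin

definition scaleC_complex :: "complex \<Rightarrow> complex \<Rightarrow> complex"
  where "scaleC_complex c x = c * x"

instance
  by standard
    (simp_all add: scaleC_complex_def algebra_simps norm_mult scaleR_conv_of_real)

end


section \<open>Dual Banach algebras\<close>

definition bounded_functionals :: "('e::complex_banach \<Rightarrow> complex) set"
  where "bounded_functionals =
    {\<phi>. bounded_linear \<phi> \<and> (\<forall>c x. \<phi> (c *\<^sub>C x) = c * \<phi> x)}"

definition isometric_dual :: "('a::complex_banach \<Rightarrow> 'e::complex_banach \<Rightarrow> complex) \<Rightarrow> bool"
  where "isometric_dual \<Phi> \<longleftrightarrow>
    bij_betw \<Phi> UNIV bounded_functionals \<and>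
    (\<forall>a b e. \<Phi> (a + b) e = \<Phi> a e + \<Phi> b e) \<and>
    (\<forall>c a e. \<Phi> (c *\<^sub>C a) e = c * \<Phi> a e) \<and>
    (\<forall>a. onorm (\<Phi> a) = norm a)"

text \<open>The topology on the function type \<open>'e \<Rightarrow> complex\<close> is that of pointwise convergence,
  so its pullback along the identification \<open>\<Phi>\<close> of \<open>'a\<close> with the dual of \<open>'e\<close>
  is the weak* topology.\<close>

definition weak_star :: "('a \<Rightarrow> 'e \<Rightarrow> complex) \<Rightarrow> 'a topology"
  where "weak_star \<Phi> = pullback_topology UNIV \<Phi> euclidean"

text \<open>\<open>'a\<close> is a dual Banach algebra with predual \<open>'e\<close>. As HOL cannot quantify over types inside
  a formula, the predual is a type parameter.\<close>

definition dual_banach_algebra ::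
    "'a::complex_banach_algebra itself \<Rightarrow> 'e::complex_banach itself \<Rightarrow> bool"
  where "dual_banach_algebra _ _ \<longleftrightarrow>
    (\<exists>\<Phi> :: 'a \<Rightarrow> 'e \<Rightarrow> complex. isometric_dual \<Phi> \<and>
      (\<forall>a. continuous_map (weak_star \<Phi>) (weak_star \<Phi>) (\<lambda>x. a * x)) \<and>
      (\<forall>a. continuous_map (weak_star \<Phi>) (weak_star \<Phi>) (\<lambda>x. x * a)))"


section \<open>Haar measure\<close>

text \<open>Groups are written additively but are not assumed commutative
  (\<^class>\<open>topological_group_add\<close> extends \<^class>\<open>group_add\<close>).\<close>

definition left_haar_measure :: "'g::topological_group_add measure \<Rightarrow> bool"
  where "left_haar_measure M \<longleftrightarrow>
    sets M = sets borel \<and>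
    emeasure M UNIV \<noteq> 0 \<and>
    (\<forall>K. compact K \<longrightarrow> emeasure M K < \<infinity>) \<and>
    (\<forall>E\<in>sets borel. emeasure M E = (INF U\<in>{U. open U \<and> E \<subseteq> U}. emeasure M U)) \<and>
    (\<forall>U. open U \<longrightarrow> emeasure M U = (SUP K\<in>{K. compact K \<and> K \<subseteq> U}. emeasure M K)) \<and>
    (\<forall>g. \<forall>E\<in>sets borel. emeasure M ((\<lambda>x. g + x) ` E) = emeasure M E)"


section \<open>Bochner integral\<close>

text \<open>The library's \<open>has_bochner_integral\<close> is restricted to second countable spaces. In the
  following version, measurability is strong measurability, so that the target space may be
  non-separable.\<close>

definition bochner_measurable :: "'x measure \<Rightarrow> ('x \<Rightarrow> 'b::real_normed_vector) \<Rightarrow> bool"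
  where "bochner_measurable M f \<longleftrightarrow>
    (\<exists>s. (\<forall>i::nat. simple_function M (s i)) \<and> (AE x in M. (\<lambda>i. s i x) \<longlonglongrightarrow> f x))"

definition has_strong_integral :: "'x measure \<Rightarrow> ('x \<Rightarrow> 'b::real_normed_vector) \<Rightarrow> 'b \<Rightarrow> bool"
  where "has_strong_integral M f y \<longleftrightarrow>
    bochner_measurable M f \<and>
    (\<exists>s. (\<forall>i::nat. Bochner_Integration.simple_bochner_integrable M (s i)) \<and>
         (\<lambda>i. \<integral>\<^sup>+x. ennreal (norm (f x - s i x)) \<partial>M) \<longlonglongrightarrow> 0 \<and>
         (\<lambda>i. Bochner_Integration.simple_bochner_integral M (s i)) \<longlonglongrightarrow> y)"

definition strong_integral :: "'x measure \<Rightarrow> ('x \<Rightarrow> 'b::real_normed_vector) \<Rightarrow> 'b"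
  where "strong_integral M f = (THE y. has_strong_integral M f y)"

text \<open>The elements are functions rather than almost-everywhere classes.\<close>

definition L1 :: "'x measure \<Rightarrow> ('x \<Rightarrow> 'b::real_normed_vector) set"
  where "L1 M = {f. bochner_measurable M f \<and> (\<integral>\<^sup>+x. ennreal (norm (f x)) \<partial>M) < \<infinity>}"


section \<open>Vector measures\<close>

text \<open>A vector measure is a function on all sets, made \<^const>\<open>undefined\<close> outside
  the Borel sets so that equality of functions is equality of vector measures.\<close>

definition vector_measure :: "('g::topological_space set \<Rightarrow> 'a::real_normed_vector) \<Rightarrow> bool"
  where "vector_measure \<mu> \<longleftrightarrow>
    \<mu> \<in> extensional (sets borel) \<and>
    (\<forall>E :: nat \<Rightarrow> 'g set. range E \<subseteq> sets borel \<longrightarrow> disjoint_family E \<longrightarrow>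
      (\<lambda>i. \<mu> (E i)) sums \<mu> (\<Union>i. E i))"

definition regular_measure :: "('g::topological_space set \<Rightarrow> 'a::real_normed_vector) \<Rightarrow> bool"
  where "regular_measure \<mu> \<longleftrightarrow>
    (\<forall>E\<in>sets borel. \<forall>\<epsilon>>0. \<exists>K U. compact K \<and> open U \<and> K \<subseteq> E \<and> E \<subseteq> U \<and>
      (\<forall>F\<in>sets borel. F \<subseteq> U - K \<longrightarrow> norm (\<mu> F) < \<epsilon>))"

definition total_variation ::
    "('g::topological_space set \<Rightarrow> 'a::real_normed_vector) \<Rightarrow> 'g set \<Rightarrow> ennreal"
  where "total_variation \<mu> E =
    (SUP P\<in>{P. finite P \<and> P \<subseteq> sets borel \<and> partition_on E P}. \<Sum>F\<in>P. ennreal (norm (\<mu> F)))"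

definition bounded_regular_measures ::
    "('g::topological_space set \<Rightarrow> 'a::real_normed_vector) set"
  where "bounded_regular_measures =
    {\<mu>. vector_measure \<mu> \<and> regular_measure \<mu> \<and> total_variation \<mu> UNIV < \<infinity>}"

definition L1_to_measure ::
    "'g::topological_space measure \<Rightarrow> ('g \<Rightarrow> 'a::real_normed_vector) \<Rightarrow> 'g set \<Rightarrow> 'a"
  where "L1_to_measure M f =
    (\<lambda>E\<in>sets borel. strong_integral M (\<lambda>x. indicator E x *\<^sub>R f x))"

end

theory Submission
  imports Defs
begin

text \<open>Atoms decide the question.

  If \<open>G\<close> is not discrete, then Haar measure has no atoms, so every measure with a Bochner density
  vanishes on singletons. The point mass at \<open>0\<close> with value \<open>1\<close> is a bounded regular vector measure
  that does not. That \<open>G\<close> is discrete as soon as \<open>{0}\<close> has positive measure comes from outer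
  regularity: \<open>{0}\<close> has an open neighbourhood of finite measure, all its points have the same positive
  mass by invariance, so it is finite, and in a Hausdorff space its finitely many other points can be
  removed (\<open>discrete_if_haar_singleton_not_null\<close>).

  If \<open>G\<close> is discrete, then Haar measure is a positive multiple \<open>c\<close> of counting measure, \<open>L\<^sup>1\<close> is the
  space of absolutely summable functions and the density \<open>f\<close> gives the measure
  \<open>E \<mapsto> c *\<^sub>R infsum f E\<close>. Compact sets being finite, regularity of a vector measure \<open>\<mu>\<close> says that
  \<open>\<mu> E\<close> is the unconditional sum of the values \<open>\<mu> {x}\<close> for \<open>x \<in> E\<close>
  (\<open>regular_measure_has_sum_atoms\<close>), and finite total variation says that these values are absolutely
  summable. Hence \<open>x \<mapsto> \<mu> {x} / c\<close> is a density of \<open>\<mu>\<close>.\<close>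

section \<open>Uniqueness of the strong integral\<close>

text \<open>As \<open>f\<close> is only almost everywhere a limit of simple functions and \<open>M\<close> need not be complete, the
  norm of \<open>f - s\<close> need not be measurable. It agrees almost everywhere with a measurable function, which
  is enough for additivity of the nonnegative integral.\<close>

lemma strongly_measurable_norm_diff:
  fixes f :: "'x \<Rightarrow> 'b::real_normed_vector"
  assumes f: "bochner_measurable M f" and s: "simple_function M s"
  obtains g where "g \<in> borel_measurable M" "AE x in M. ennreal (norm (f x - s x)) = g x"
proof -
  obtain h where h: "\<And>i::nat. simple_function M (h i)" "AE x in M. (\<lambda>i. h i x) \<longlonglongrightarrow> f x"
    using f unfolding bochner_measurable_def by blast
  \<comment> \<open>A lower limit is measurable everywhere, including the null set where \<open>h\<close> does not converge.\<close>
  define g where "g x = liminf (\<lambda>i. ennreal (norm (h i x - s x)))" for x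
  have "simple_function M (\<lambda>x. ennreal (norm (h i x - s x)))" for i
    using simple_function_compose2[OF h(1) s, of "\<lambda>a b. ennreal (norm (a - b))"] .
  then have "g \<in> borel_measurable M"
    unfolding g_def by (intro borel_measurable_liminf borel_measurable_simple_function)
  moreover have "AE x in M. ennreal (norm (f x - s x)) = g x"
    using h(2)
  proof eventually_elim
    case (elim x)
    then have "(\<lambda>i. ennreal (norm (h i x - s x))) \<longlonglongrightarrow> ennreal (norm (f x - s x))"
      by (intro tendsto_intros)
    then show ?case
      unfolding g_def by (intro lim_imp_Liminf[symmetric]) auto
  qed
  ultimately show ?thesis by (rule that)
qed

text \<open>The triangle inequality for \<open>s - t = (f - t) - (f - s)\<close>, with the measurable representatives of
  the two norms in place of the norms themselves.\<close>

lemma simple_integral_dist_le: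
  fixes f :: "'x \<Rightarrow> 'b::real_normed_vector"
  assumes f: "bochner_measurable M f"
    and s: "Bochner_Integration.simple_bochner_integrable M s"
    and t: "Bochner_Integration.simple_bochner_integrable M t"
  shows "ennreal (norm (Bochner_Integration.simple_bochner_integral M s
      - Bochner_Integration.simple_bochner_integral M t))
    \<le> (\<integral>\<^sup>+x. ennreal (norm (f x - s x)) \<partial>M) + (\<integral>\<^sup>+x. ennreal (norm (f x - t x)) \<partial>M)"
proof -
  have sf: "simple_function M s" "simple_function M t"
    using s t by (auto elim: Bochner_Integration.simple_bochner_integrable.cases)
  obtain g where g: "g \<in> borel_measurable M" "AE x in M. ennreal (norm (f x - s x)) = g x"
    by (rule strongly_measurable_norm_diff[OF f sf(1)])
  obtain k where k: "k \<in> borel_measurable M" "AE x in M. ennreal (norm (f x - t x)) = k x"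
    by (rule strongly_measurable_norm_diff[OF f sf(2)])
  have st: "Bochner_Integration.simple_bochner_integrable M (\<lambda>x. s x - t x)"
    by (rule Bochner_Integration.simple_bochner_integrable_compose2[OF _ s t]) simp
  have nst: "Bochner_Integration.simple_bochner_integrable M (\<lambda>x. norm (s x - t x))"
    by (rule Bochner_Integration.simple_bochner_integrable_compose2[OF _ s t]) simp
  have "ennreal (norm (Bochner_Integration.simple_bochner_integral M s
      - Bochner_Integration.simple_bochner_integral M t))
    = ennreal (norm (Bochner_Integration.simple_bochner_integral M (\<lambda>x. s x - t x)))"
    using s t by (simp add: Bochner_Integration.simple_bochner_integral_diff)
  also have "\<dots> \<le> ennreal (Bochner_Integration.simple_bochner_integral M (\<lambda>x. norm (s x - t x)))"
    by (intro ennreal_leI Bochner_Integration.simple_bochner_integral_norm_bound st)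
  also have "\<dots> = (\<integral>\<^sup>+x. ennreal (norm (s x - t x)) \<partial>M)"
    by (intro Bochner_Integration.simple_bochner_integral_eq_nn_integral nst) simp
  also have "\<dots> \<le> (\<integral>\<^sup>+x. g x + k x \<partial>M)"
  proof (rule nn_integral_mono_AE)
    show "AE x in M. ennreal (norm (s x - t x)) \<le> g x + k x"
      using g(2) k(2)
    proof eventually_elim
      case (elim x)
      have "norm (s x - t x) \<le> norm (f x - s x) + norm (f x - t x)"
        by (metis norm_triangle_sub norm_minus_commute diff_add_cancel norm_diff_triangle_le order_refl)
      then have "ennreal (norm (s x - t x)) \<le> ennreal (norm (f x - s x) + norm (f x - t x))"
        by (rule ennreal_leI)
      then show ?case using elim by simp
    qed
  qed
  also have "\<dots> = (\<integral>\<^sup>+x. g x \<partial>M) + (\<integral>\<^sup>+x. k x \<partial>M)"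
    by (rule nn_integral_add[OF g(1) k(1)])
  also have "\<dots> = (\<integral>\<^sup>+x. ennreal (norm (f x - s x)) \<partial>M) + (\<integral>\<^sup>+x. ennreal (norm (f x - t x)) \<partial>M)"
    using nn_integral_cong_AE[OF g(2)] nn_integral_cong_AE[OF k(2)] by simp
  finally show ?thesis .
qed

lemma has_strong_integral_unique:
  fixes f :: "'x \<Rightarrow> 'b::real_normed_vector"
  assumes "has_strong_integral M f y" "has_strong_integral M f z"
  shows "y = z"
proof -
  obtain s where f: "bochner_measurable M f"
    and s: "\<And>i::nat. Bochner_Integration.simple_bochner_integrable M (s i)"
      "(\<lambda>i. \<integral>\<^sup>+x. ennreal (norm (f x - s i x)) \<partial>M) \<longlonglongrightarrow> 0"
      "(\<lambda>i. Bochner_Integration.simple_bochner_integral M (s i)) \<longlonglongrightarrow> y"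
    using assms(1) unfolding has_strong_integral_def by blast
  obtain t where t: "\<And>i::nat. Bochner_Integration.simple_bochner_integrable M (t i)"
      "(\<lambda>i. \<integral>\<^sup>+x. ennreal (norm (f x - t i x)) \<partial>M) \<longlonglongrightarrow> 0"
      "(\<lambda>i. Bochner_Integration.simple_bochner_integral M (t i)) \<longlonglongrightarrow> z"
    using assms(2) unfolding has_strong_integral_def by blast
  let ?d = "\<lambda>i. ennreal (norm (Bochner_Integration.simple_bochner_integral M (s i)
      - Bochner_Integration.simple_bochner_integral M (t i)))"
  have "?d \<longlonglongrightarrow> ennreal (norm (y - z))"
    by (intro tendsto_intros s(3) t(3))
  moreover have "?d \<longlonglongrightarrow> 0"
  proof (rule tendsto_sandwich[OF _ _ tendsto_const])
    show "(\<lambda>i. (\<integral>\<^sup>+x. ennreal (norm (f x - s i x)) \<partial>M)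
        + (\<integral>\<^sup>+x. ennreal (norm (f x - t i x)) \<partial>M)) \<longlonglongrightarrow> 0"
      using tendsto_add[OF s(2) t(2)] by simp
    show "\<forall>\<^sub>F i in sequentially. ?d i \<le> (\<integral>\<^sup>+x. ennreal (norm (f x - s i x)) \<partial>M)
        + (\<integral>\<^sup>+x. ennreal (norm (f x - t i x)) \<partial>M)"
      by (intro always_eventually allI simple_integral_dist_le[OF f s(1) t(1)])
    show "\<forall>\<^sub>F i in sequentially. 0 \<le> ?d i" by simp
  qed
  ultimately have "ennreal (norm (y - z)) = 0"
    by (rule LIMSEQ_unique)
  then show ?thesis by simp
qed

lemma strong_integral_eqI:
  assumes "has_strong_integral M f y"
  shows "strong_integral M f = y"
  unfolding strong_integral_def
  using assms has_strong_integral_unique by (intro the_equality)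

lemma has_strong_integral_null:
  fixes f :: "'x \<Rightarrow> 'b::real_normed_vector"
  assumes "AE x in M. f x = 0"
  shows "has_strong_integral M f 0"
  unfolding has_strong_integral_def bochner_measurable_def
proof (intro conjI exI allI)
  show "simple_function M (\<lambda>x. 0 :: 'b)" for i :: nat by simp
  show "AE x in M. (\<lambda>i::nat. 0) \<longlonglongrightarrow> f x"
    using assms by eventually_elim simp
  show "Bochner_Integration.simple_bochner_integrable M (\<lambda>x. 0 :: 'b)" for i :: nat
    by (auto intro: Bochner_Integration.simple_bochner_integrable.intros)
  have "(\<integral>\<^sup>+x. ennreal (norm (f x - 0)) \<partial>M) = (\<integral>\<^sup>+x. 0 \<partial>M)"
    by (rule nn_integral_cong_AE) (use assms in eventually_elim, simp)
  then show "(\<lambda>i::nat. \<integral>\<^sup>+x. ennreal (norm (f x - 0)) \<partial>M) \<longlonglongrightarrow> 0"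
    by simp
  show "(\<lambda>i::nat. Bochner_Integration.simple_bochner_integral M (\<lambda>x. 0 :: 'b)) \<longlonglongrightarrow> 0"
    unfolding Bochner_Integration.simple_bochner_integral_def by (simp add: sum.neutral)
qed

section \<open>Point masses\<close>

definition point_mass :: "'g::topological_space \<Rightarrow> 'a::real_normed_vector \<Rightarrow> 'g set \<Rightarrow> 'a"
  where "point_mass x a = (\<lambda>E\<in>sets borel. indicator E x *\<^sub>R a)"

text \<open>For regularity, \<open>x\<close> is put into \<open>K\<close> if it lies in \<open>E\<close> and is removed from \<open>U\<close> otherwise,
  which is possible because points are compact and closed. A partition has just one member that
  contains \<open>x\<close>, which bounds the variation by the norm of \<open>a\<close>.\<close>

lemma point_mass_bounded_regular:
  fixes x :: "'g::t1_space"
  shows "point_mass x a \<in> bounded_regular_measures"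
proof -
  have "vector_measure (point_mass x a)"
    unfolding vector_measure_def
  proof (intro conjI allI impI)
    show "point_mass x a \<in> extensional (sets borel)"
      by (simp add: point_mass_def)
    fix E :: "nat \<Rightarrow> 'g set" assume E: "range E \<subseteq> sets borel" "disjoint_family E"
    then have "(\<Union>i. E i) \<in> sets borel" by blast
    moreover have "(\<lambda>i. indicator (E i) x *\<^sub>R a) sums (indicator (\<Union>i. E i) x *\<^sub>R a)"
      by (intro sums_scaleR_left indicator_sums) (use E in \<open>auto simp: disjoint_family_on_def\<close>)
    ultimately show "(\<lambda>i. point_mass x a (E i)) sums point_mass x a (\<Union>i. E i)"
      using E by (simp add: point_mass_def range_subsetD)
  qed
  moreover have "regular_measure (point_mass x a)"
    unfolding regular_measure_def
  proof (intro ballI allI impI)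
    fix E :: "'g set" and \<epsilon> :: real assume "0 < \<epsilon>"
    define K where "K = E \<inter> {x}"
    define U where "U = (if x \<in> E then UNIV else - {x})"
    have "compact K" unfolding K_def by (intro finite_imp_compact) simp
    moreover have "open U" unfolding U_def by (simp add: open_Compl)
    moreover have "K \<subseteq> E" "E \<subseteq> U" "x \<notin> U - K" unfolding K_def U_def by auto
    ultimately show "\<exists>K U. compact K \<and> open U \<and> K \<subseteq> E \<and> E \<subseteq> U \<and>
        (\<forall>F\<in>sets borel. F \<subseteq> U - K \<longrightarrow> norm (point_mass x a F) < \<epsilon>)"
      using \<open>0 < \<epsilon>\<close>
      by (intro exI[of _ K] exI[of _ U]) (auto simp: point_mass_def indicator_def)
  qed
  moreover have "total_variation (point_mass x a) UNIV < \<infinity>"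
  proof -
    have "total_variation (point_mass x a) UNIV \<le> ennreal (norm a)"
      unfolding total_variation_def
    proof (rule SUP_least, clarify)
      fix P :: "'g set set"
      assume P: "finite P" "P \<subseteq> sets borel" "partition_on UNIV P"
      obtain F where F: "F \<in> P" "x \<in> F"
        using P(3) unfolding partition_on_def by blast
      have "x \<notin> E" if "E \<in> P - {F}" for E
        using P(3) F that unfolding partition_on_def disjoint_def by blast
      then have "(\<Sum>F\<in>P. ennreal (norm (point_mass x a F)))
          = (\<Sum>F\<in>{F}. ennreal (norm (point_mass x a F)))"
        using P F by (intro sum.mono_neutral_right)
          (auto simp: point_mass_def)
      also have "\<dots> \<le> ennreal (norm a)"
        using P F by (auto simp: point_mass_def)
      finally show "(\<Sum>F\<in>P. ennreal (norm (point_mass x a F))) \<le> ennreal (norm a)" .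
    qed
    also have "\<dots> < \<infinity>" by simp
    finally show ?thesis .
  qed
  ultimately show ?thesis
    unfolding bounded_regular_measures_def by simp
qed

lemma singleton_not_null_if_point_mass_has_density:
  fixes M :: "'g::t1_space measure" and a :: "'a::real_normed_vector"
  assumes M: "sets M = sets borel" and a: "a \<noteq> 0"
    and f: "point_mass x a = L1_to_measure M f"
  shows "emeasure M {x} \<noteq> 0"
proof
  assume "emeasure M {x} = 0"
  then have "{x} \<in> null_sets M"
    by (simp add: null_sets_def M)
  then have "AE y in M. y \<notin> {x}"
    by (rule AE_not_in)
  then have "AE y in M. indicator {x} y *\<^sub>R f y = 0"
    by eventually_elim simp
  then have "strong_integral M (\<lambda>y. indicator {x} y *\<^sub>R f y) = 0"
    by (intro strong_integral_eqI has_strong_integral_null)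
  then have "L1_to_measure M f {x} = 0"
    by (simp add: L1_to_measure_def)
  moreover have "point_mass x a {x} = a"
    by (simp add: point_mass_def)
  ultimately show False using a f by simp
qed

section \<open>Haar measure with atoms\<close>

lemma emeasure_infinite_equal_atoms:
  assumes S: "infinite S" "S \<in> sets M" and c: "c \<noteq> 0"
    and atoms: "\<And>x. x \<in> S \<Longrightarrow> {x} \<in> sets M \<and> emeasure M {x} = c"
  shows "emeasure M S = \<infinity>"
proof -
  have "of_nat n * c \<le> emeasure M S" for n :: nat
  proof -
    obtain F where F: "finite F" "card F = n" "F \<subseteq> S"
      using infinite_arbitrarily_large[OF S(1)] by blast
    have "of_nat n * c = (\<Sum>x\<in>F. emeasure M {x})"
      using F atoms by (simp add: subset_iff)
    also have "\<dots> = emeasure M F"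
      using F atoms by (intro emeasure_eq_sum_singleton[symmetric]) auto
    also have "\<dots> \<le> emeasure M S"
      using F S by (intro emeasure_mono)
    finally show ?thesis .
  qed
  then have "(SUP n. of_nat n * c) \<le> emeasure M S"
    by (intro SUP_least)
  moreover have "(SUP n. of_nat n * c) = \<infinity>"
    using c by (simp add: SUP_mult_right_ennreal[symmetric] ennreal_SUP_of_nat_eq_top ennreal_top_mult)
  ultimately show ?thesis
    by (simp add: top_unique)
qed

lemma left_haar_measureD:
  fixes haar :: "'g::topological_group_add measure"
  assumes "left_haar_measure haar"
  shows "sets haar = sets borel"
    and "emeasure haar UNIV \<noteq> 0"
    and "compact K \<Longrightarrow> emeasure haar K < \<infinity>"
    and "E \<in> sets borel \<Longrightarrow> emeasure haar E = (INF U\<in>{U. open U \<and> E \<subseteq> U}. emeasure haar U)"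
    and "open V \<Longrightarrow> emeasure haar V = (SUP K\<in>{K. compact K \<and> K \<subseteq> V}. emeasure haar K)"
    and "E \<in> sets borel \<Longrightarrow> emeasure haar ((\<lambda>x. g + x) ` E) = emeasure haar E"
proof -
  note haar = assms[unfolded left_haar_measure_def]
  note rest = haar[THEN conjunct2, THEN conjunct2]
  show "sets haar = sets borel"
    by (rule haar[THEN conjunct1])
  show "emeasure haar UNIV \<noteq> 0"
    by (rule haar[THEN conjunct2, THEN conjunct1])
  show "compact K \<Longrightarrow> emeasure haar K < \<infinity>"
    by (rule rest[THEN conjunct1, rule_format])
  show "E \<in> sets borel \<Longrightarrow> emeasure haar E = (INF U\<in>{U. open U \<and> E \<subseteq> U}. emeasure haar U)"
    by (rule rest[THEN conjunct2, THEN conjunct1, THEN bspec])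
  show "open V \<Longrightarrow> emeasure haar V = (SUP K\<in>{K. compact K \<and> K \<subseteq> V}. emeasure haar K)"
    by (rule rest[THEN conjunct2, THEN conjunct2, THEN conjunct1, rule_format])
  show "E \<in> sets borel \<Longrightarrow> emeasure haar ((\<lambda>x. g + x) ` E) = emeasure haar E"
    by (rule rest[THEN conjunct2, THEN conjunct2, THEN conjunct2, rule_format])
qed

lemma haar_singleton:
  fixes haar :: "'g::{topological_group_add, t2_space} measure"
  assumes "left_haar_measure haar"
  shows "emeasure haar {x} = emeasure haar {0}"
proof -
  have "emeasure haar ((\<lambda>y. x + y) ` {0}) = emeasure haar {0}"
    by (rule left_haar_measureD(6)[OF assms]) simp
  then show ?thesis by simp
qed

lemma haar_singleton_finite:
  fixes haar :: "'g::{topological_group_add, t2_space} measure"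
  assumes "left_haar_measure haar"
  shows "emeasure haar {x} < \<infinity>"
  by (rule left_haar_measureD(3)[OF assms]) simp

text \<open>Invariance gives all points the same positive mass, so an open set of finite measure is finite;
  outer regularity provides such a set around \<open>0\<close>.\<close>

lemma discrete_if_haar_singleton_not_null:
  fixes haar :: "'g::{topological_group_add, t2_space} measure"
  assumes haar: "left_haar_measure haar" and nz: "emeasure haar {0} \<noteq> 0"
  shows "(euclidean :: 'g topology) = discrete_topology UNIV"
proof -
  have sets: "sets haar = sets borel"
    by (rule left_haar_measureD(1)[OF haar])
  have "emeasure haar {0} = (INF U\<in>{U. open U \<and> {0} \<subseteq> U}. emeasure haar U)"
    by (rule left_haar_measureD(4)[OF haar]) simp
  then have "(INF U\<in>{U. open U \<and> {0} \<subseteq> U}. emeasure haar U) < \<infinity>"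
    using haar_singleton_finite[OF haar, of 0] by order
  then obtain U where U: "open U" "0 \<in> U" "emeasure haar U < \<infinity>"
    unfolding INF_less_iff by auto
  have "finite U"
  proof (rule ccontr)
    assume "infinite U"
    then have "emeasure haar U = \<infinity>"
      using U(1) nz haar_singleton[OF haar]
      by (intro emeasure_infinite_equal_atoms[where c = "emeasure haar {0}"]) (simp_all add: sets)
    then show False using U(3) by simp
  qed
  then have "open (U - (U - {0}))"
    using U by (intro open_Diff finite_imp_closed) auto
  also have "U - (U - {0}) = {0}" using U by auto
  finally have "open {0::'g}" .
  then have "open ((\<lambda>y. - x + y) -` {0})" for x :: 'g
    by (rule open_vimage) (intro continuous_intros)
  moreover have "(\<lambda>y. - x + y) -` {0} = {x}" for x :: 'g
    by (auto simp: add_eq_0_iff2)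
  ultimately have "open {x}" for x :: 'g by simp
  then have "discrete_topology UNIV = (euclidean :: 'g topology)"
    by (subst discrete_topology_unique) simp
  then show ?thesis
    by (rule sym)
qed

abbreviation weighted_count :: "real \<Rightarrow> 'x measure"
  where "weighted_count c \<equiv> scale_measure (ennreal c) (count_space UNIV)"

text \<open>The common mass of the points is finite as points are compact. It is positive by inner
  regularity of the whole group: compact sets are finite, so a zero mass would make the whole measure
  zero.\<close>

lemma haar_discrete:
  fixes haar :: "'g::{topological_group_add, t2_space} measure"
  assumes haar: "left_haar_measure haar"
    and discrete: "(euclidean :: 'g topology) = discrete_topology UNIV"
  obtains c where "0 < c" "haar = weighted_count c"
proof -
  have open_all: "open S" for S :: "'g set"
    using discrete by (simp add: open_openin)
  have sets: "sets haar = UNIV"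
    using left_haar_measureD(1)[OF haar] open_all by auto
  define c where "c = emeasure haar {0}"
  have atom: "emeasure haar {x} = c" for x
    unfolding c_def by (rule haar_singleton[OF haar])
  have fin: "emeasure haar F = of_nat (card F) * c" if "finite F" for F
    using that by (subst emeasure_eq_sum_singleton) (auto simp: sets atom)
  have "c \<noteq> 0"
  proof
    assume "c = 0"
    have "emeasure haar UNIV = (SUP K\<in>{K. compact K \<and> K \<subseteq> UNIV}. emeasure haar K)"
      by (rule left_haar_measureD(5)[OF haar]) simp
    also have "\<dots> = (SUP K\<in>{K :: 'g set. compact K \<and> K \<subseteq> UNIV}. 0)"
    proof (rule SUP_cong[OF refl], clarify)
      fix K :: "'g set" assume "compact K"
      then have "finite K"
        using discrete compactin_discrete_topology[of UNIV K]
        by (simp flip: compactin_euclidean_iff)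
      then show "emeasure haar K = 0"
        using fin \<open>c = 0\<close> by simp
    qed
    also have "\<dots> = 0"
      by (intro SUP_eq_const) auto
    finally show False
      using left_haar_measureD(2)[OF haar] by simp
  qed
  moreover have "c < \<infinity>"
    unfolding c_def by (rule haar_singleton_finite[OF haar])
  ultimately obtain r where r: "c = ennreal r" "0 < r"
    by (cases c) (auto simp: less_le)
  have "haar = weighted_count r"
  proof (rule measure_eqI)
    fix A assume "A \<in> sets haar"
    show "emeasure haar A = emeasure (weighted_count r) A"
    proof (cases "finite A")
      case True
      then show ?thesis using fin r by (simp add: mult.commute)
    next
      case False
      then show ?thesis
        using emeasure_infinite_equal_atoms[of A haar c] \<open>c \<noteq> 0\<close> r
        by (simp add: sets atom ennreal_mult_top)
    qed
  qed (simp add: sets)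
  with r show ?thesis using that by blast
qed

section \<open>Integration against a multiple of counting measure\<close>

lemma nn_integral_weighted_count:
  fixes g :: "'x \<Rightarrow> real"
  assumes "g summable_on UNIV" "\<And>x. 0 \<le> g x" "0 < c"
  shows "(\<integral>\<^sup>+x. ennreal (g x) \<partial>weighted_count c) = ennreal (c * infsum g UNIV)"
proof -
  have g: "Infinite_Set_Sum.abs_summable_on g UNIV"
    using assms(1,2) by (simp flip: abs_summable_equivalent)
  have "(\<integral>\<^sup>+x. ennreal (g x) \<partial>weighted_count c)
      = ennreal c * (\<integral>\<^sup>+x. ennreal (g x) \<partial>count_space UNIV)"
    by (rule nn_integral_scale_measure) simp
  also have "\<dots> = ennreal c * ennreal (infsum g UNIV)"
    using nn_integral_conv_infsetsum[OF g] assms(2) by (simp add: infsetsum_infsum[OF g])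
  also have "\<dots> = ennreal (c * infsum g UNIV)"
    using assms by (simp add: ennreal_mult infsum_nonneg)
  finally show ?thesis .
qed

lemma summable_if_nn_integral_weighted_count_finite:
  fixes g :: "'x \<Rightarrow> real"
  assumes "\<And>x. 0 \<le> g x" "0 < c" "(\<integral>\<^sup>+x. ennreal (g x) \<partial>weighted_count c) < \<infinity>"
  shows "g summable_on UNIV"
proof -
  have "(\<integral>\<^sup>+x. ennreal (g x) \<partial>weighted_count c)
      = ennreal c * (\<integral>\<^sup>+x. ennreal (g x) \<partial>count_space UNIV)"
    by (rule nn_integral_scale_measure) simp
  then have "(\<integral>\<^sup>+x. ennreal (g x) \<partial>count_space UNIV) < \<infinity>"
    using assms(2,3) by (auto simp: ennreal_mult_less_top)
  then have "integrable (count_space UNIV) g"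
    using assms(1) by (intro integrableI_bounded) auto
  then have "Infinite_Set_Sum.abs_summable_on g UNIV"
    by (simp add: Infinite_Set_Sum.abs_summable_on_def)
  then show ?thesis
    using assms(1) by (simp flip: abs_summable_equivalent)
qed

text \<open>The integral of a simple function groups points by their values. The partition of the space into
  the points of \<open>K\<close> and the rest refines this grouping, and computing with it yields a sum over
  points.\<close>

lemma finite_support_simple_integral:
  fixes s :: "'x \<Rightarrow> 'b::real_normed_vector"
  assumes K: "finite K" "\<And>x. x \<notin> K \<Longrightarrow> s x = 0" and c: "0 < c"
  shows "Bochner_Integration.simple_bochner_integrable (weighted_count c) s"
    and "Bochner_Integration.simple_bochner_integral (weighted_count c) s = c *\<^sub>R sum s K"
proof -
  let ?M = "weighted_count c :: 'x measure"
  have space: "space ?M = UNIV" by (simp add: space_scale_measure)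
  have simple: "simple_function ?M h" if "finite (range h)" for h :: "'x \<Rightarrow> 'z"
    using that by (simp add: simple_function_def space)
  have "range s \<subseteq> insert 0 (s ` K)" using K(2) by auto
  then have s: "simple_function ?M s"
    using K(1) by (intro simple) (auto intro: finite_subset)
  have "{x. s x \<noteq> 0} \<subseteq> K" using K(2) by auto
  then have "finite {x. s x \<noteq> 0}" using K(1) by (rule finite_subset)
  then have "emeasure ?M {x \<in> space ?M. s x \<noteq> 0} \<noteq> \<infinity>"
    by (simp add: space ennreal_mult_eq_top_iff)
  with s show int: "Bochner_Integration.simple_bochner_integrable ?M s"
    by (rule Bochner_Integration.simple_bochner_integrable.intros)
  \<comment> \<open>The partition is given by the fibres of \<open>g\<close>, and \<open>v\<close> recovers \<open>s\<close> from them.\<close>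
  define g where "g x = (if x \<in> K then Some x else None)" for x
  define v where "v y = (case y of None \<Rightarrow> 0 | Some x \<Rightarrow> s x)" for y
  have range_g: "range g \<subseteq> insert None (Some ` K)" by (auto simp: g_def)
  have g: "simple_function ?M g"
    using K(1) range_g by (intro simple) (auto intro: finite_subset)
  have "Bochner_Integration.simple_bochner_integral ?M s
      = (\<Sum>y\<in>g ` space ?M. measure ?M {x \<in> space ?M. g x = y} *\<^sub>R v y)"
    by (rule Bochner_Integration.simple_bochner_integral_partition[OF int g])
      (auto simp: g_def v_def K(2) split: if_splits)
  also have "\<dots> = (\<Sum>y\<in>insert None (Some ` K). measure ?M {x. g x = y} *\<^sub>R v y)"
    unfolding space using K(1) range_g
  proof (intro sum.mono_neutral_cong_left)
    show "\<forall>i\<in>insert None (Some ` K) - range g. measure ?M {x. g x = i} *\<^sub>R v i = 0"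
    proof
      fix i assume "i \<in> insert None (Some ` K) - range g"
      then have "{x. g x = i} = {}" by auto
      then show "measure ?M {x. g x = i} *\<^sub>R v i = 0" by (simp only: measure_empty) simp
    qed
  qed auto
  also have "\<dots> = (\<Sum>x\<in>K. measure ?M {y. g y = Some x} *\<^sub>R s x)"
    using K(1) by (subst sum.insert) (auto simp: v_def sum.reindex)
  also have "\<dots> = (\<Sum>x\<in>K. c *\<^sub>R s x)"
  proof (rule sum.cong[OF refl])
    fix x assume "x \<in> K"
    then have "{y. g y = Some x} = {x}" by (auto simp: g_def split: if_splits)
    then show "measure ?M {y. g y = Some x} *\<^sub>R s x = c *\<^sub>R s x"
      using c by simp
  qed
  finally show "Bochner_Integration.simple_bochner_integral ?M s = c *\<^sub>R sum s K"
    by (simp add: scaleR_sum_right)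
qed

lemma abs_summable_finite_tail:
  fixes f :: "'x \<Rightarrow> 'b::real_normed_vector"
  assumes f: "(\<lambda>x. norm (f x)) summable_on A" and "0 < \<epsilon>"
  obtains K where "finite K" "K \<subseteq> A" "infsum (\<lambda>x. norm (f x)) (A - K) < \<epsilon>"
proof -
  obtain K where K: "finite K" "K \<subseteq> A"
    "dist (\<Sum>x\<in>K. norm (f x)) (infsum (\<lambda>x. norm (f x)) A) \<le> \<epsilon> / 2"
    using infsum_finite_approximation[OF f, of "\<epsilon> / 2"] \<open>0 < \<epsilon>\<close> by auto
  have "infsum (\<lambda>x. norm (f x)) (A - K) = infsum (\<lambda>x. norm (f x)) A - (\<Sum>x\<in>K. norm (f x))"
    using K f by (subst infsum_Diff) auto
  also have "\<dots> < \<epsilon>"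
    using K(3) \<open>0 < \<epsilon>\<close> unfolding dist_real_def by linarith
  finally show ?thesis using that K by blast
qed

text \<open>Cutting \<open>f\<close> off outside finite sets gives simple functions, and the tail of the series of norms
  bounds all three errors, the last two up to the factor \<open>c\<close>: pointwise, in mean, and of the integrals.\<close>

lemma has_strong_integral_weighted_count:
  fixes f :: "'x \<Rightarrow> 'b::banach"
  assumes f: "(\<lambda>x. norm (f x)) summable_on UNIV" and c: "0 < c"
  shows "has_strong_integral (weighted_count c) f (c *\<^sub>R infsum f UNIV)"
proof -
  let ?M = "weighted_count c :: 'x measure"
  have "\<exists>K. finite K \<and> infsum (\<lambda>x. norm (f x)) (- K) < inverse (real (Suc i))" for i
    by (rule abs_summable_finite_tail[OF f, of "inverse (real (Suc i))"])
      (auto simp: Compl_eq_Diff_UNIV)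
  then obtain K where K: "\<And>i. finite (K i)"
    "\<And>i. infsum (\<lambda>x. norm (f x)) (- K i) < inverse (real (Suc i))"
    by metis
  define s where "s i x = (if x \<in> K i then f x else 0)" for i x
  have sum_on: "(\<lambda>x. norm (f x)) summable_on B" for B
    using f by (rule summable_on_subset_banach) simp
  have diff: "norm (f x - s i x) = (if x \<in> - K i then norm (f x) else 0)" for i x
    by (simp add: s_def)
  have tail: "(\<lambda>x. norm (f x - s i x)) summable_on UNIV"
    "infsum (\<lambda>x. norm (f x - s i x)) UNIV = infsum (\<lambda>x. norm (f x)) (- K i)" for i
  proof -
    show "(\<lambda>x. norm (f x - s i x)) summable_on UNIV"
      by (rule summable_on_cong_neutral[THEN iffD1, OF _ _ _ sum_on[of "- K i"]]) (auto simp: diff)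
    show "infsum (\<lambda>x. norm (f x - s i x)) UNIV = infsum (\<lambda>x. norm (f x)) (- K i)"
      by (rule infsum_cong_neutral) (auto simp: diff)
  qed
  have bound_to_0: "(\<lambda>i. inverse (real (Suc i))) \<longlonglongrightarrow> 0"
    by (rule LIMSEQ_inverse_real_of_nat)
  have tail_to_0: "(\<lambda>i. infsum (\<lambda>x. norm (f x)) (- K i)) \<longlonglongrightarrow> 0"
    by (rule tendsto_sandwich[OF _ _ tendsto_const bound_to_0])
      (intro always_eventually allI infsum_nonneg norm_ge_zero less_imp_le[OF K(2)])+
  have "(\<lambda>i. s i x) \<longlonglongrightarrow> f x" for x
  proof (rule Lim_transform2[OF tendsto_const], rule Lim_null_comparison[OF _ tail_to_0],
      rule always_eventually, rule allI)
    fix i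
    have "norm (f x - s i x) \<le> infsum (\<lambda>x. norm (f x - s i x)) UNIV"
      using finite_sum_le_infsum[OF tail(1), of "{x}" i] by simp
    then show "norm (f x - s i x) \<le> infsum (\<lambda>x. norm (f x)) (- K i)"
      by (simp add: tail(2))
  qed
  moreover have simple: "Bochner_Integration.simple_bochner_integrable ?M (s i)"
    "Bochner_Integration.simple_bochner_integral ?M (s i) = c *\<^sub>R sum f (K i)" for i
    using finite_support_simple_integral[OF K(1)[of i], of "s i" c] c by (auto simp: s_def)
  ultimately have "bochner_measurable ?M f"
    unfolding bochner_measurable_def
    by (intro exI[of _ s]) (auto elim: Bochner_Integration.simple_bochner_integrable.cases)
  moreover have "(\<lambda>i. \<integral>\<^sup>+x. ennreal (norm (f x - s i x)) \<partial>?M) \<longlonglongrightarrow> 0"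
  proof -
    have "(\<lambda>i. ennreal (c * infsum (\<lambda>x. norm (f x)) (- K i))) \<longlonglongrightarrow> ennreal (c * 0)"
      by (intro tendsto_intros tail_to_0)
    then show ?thesis
      using c by (simp add: nn_integral_weighted_count[OF tail(1)] tail(2))
  qed
  moreover have "(\<lambda>i. Bochner_Integration.simple_bochner_integral ?M (s i)) \<longlonglongrightarrow> c *\<^sub>R infsum f UNIV"
    unfolding simple(2)
  proof (intro tendsto_intros, rule Lim_transform2[OF tendsto_const],
      rule Lim_null_comparison[OF _ tail_to_0], rule always_eventually, rule allI)
    fix i
    have "infsum f UNIV - sum f (K i) = infsum f (- K i)"
      using abs_summable_summable[OF f] K(1) by (simp add: Compl_eq_Diff_UNIV infsum_Diff)
    then show "norm (infsum f UNIV - sum f (K i)) \<le> infsum (\<lambda>x. norm (f x)) (- K i)"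
      using norm_infsum_bound[OF sum_on] by simp
  qed
  ultimately show ?thesis
    unfolding has_strong_integral_def using simple(1) by blast
qed

lemma L1_weighted_count:
  assumes c: "0 < c"
  shows "(L1 (weighted_count c) :: ('x \<Rightarrow> 'b::banach) set) = {f. (\<lambda>x. norm (f x)) summable_on UNIV}"
proof (intro set_eqI iffI; clarify)
  fix f :: "'x \<Rightarrow> 'b"
  assume "f \<in> L1 (weighted_count c)"
  then show "(\<lambda>x. norm (f x)) summable_on UNIV"
    using summable_if_nn_integral_weighted_count_finite[of "\<lambda>x. norm (f x)" c] c by (simp add: L1_def)
next
  fix f :: "'x \<Rightarrow> 'b"
  assume f: "(\<lambda>x. norm (f x)) summable_on UNIV"
  then show "f \<in> L1 (weighted_count c)"
    using has_strong_integral_weighted_count[OF f c] nn_integral_weighted_count[OF f _ c]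
    by (simp add: L1_def has_strong_integral_def)
qed

lemma L1_to_measure_weighted_count:
  fixes f :: "'g::topological_space \<Rightarrow> 'b::banach"
  assumes f: "(\<lambda>x. norm (f x)) summable_on UNIV" and c: "0 < c"
  shows "L1_to_measure (weighted_count c) f = (\<lambda>E\<in>sets borel. c *\<^sub>R infsum f E)"
  unfolding L1_to_measure_def
proof (rule restrict_ext)
  fix E :: "'g set"
  let ?g = "\<lambda>x. indicator E x *\<^sub>R f x"
  have "(\<lambda>x. norm (?g x)) summable_on UNIV"
    by (rule Infinite_Sum.abs_summable_on_comparison_test[OF f]) (simp add: indicator_def)
  then have "strong_integral (weighted_count c) ?g = c *\<^sub>R infsum ?g UNIV"
    by (intro strong_integral_eqI has_strong_integral_weighted_count c)
  also have "infsum ?g UNIV = infsum f E"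
    by (rule infsum_cong_neutral) (auto simp: indicator_def)
  finally show "strong_integral (weighted_count c) ?g = c *\<^sub>R infsum f E" .
qed

section \<open>Vector measures on a discrete space\<close>

lemma vector_measure_empty:
  assumes "vector_measure \<mu>"
  shows "\<mu> {} = 0"
proof -
  have "(\<lambda>i::nat. \<mu> {}) sums \<mu> (\<Union>i::nat. {})"
    by (rule assms[unfolded vector_measure_def, THEN conjunct2, rule_format])
      (auto simp: disjoint_family_on_def)
  then have "summable (\<lambda>i::nat. \<mu> {})" by (rule sums_summable)
  then show ?thesis by (simp add: summable_const_iff)
qed

lemma vector_measure_Un:
  assumes \<mu>: "vector_measure \<mu>" and AB: "A \<in> sets borel" "B \<in> sets borel" "A \<inter> B = {}"
  shows "\<mu> (A \<union> B) = \<mu> A + \<mu> B"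
proof -
  have "(\<lambda>i. \<mu> (binaryset A B i)) sums \<mu> (\<Union>i. binaryset A B i)"
    by (rule \<mu>[unfolded vector_measure_def, THEN conjunct2, rule_format])
      (use AB in \<open>auto simp: range_binaryset_eq disjoint_family_on_def binaryset_def\<close>)
  moreover have "(\<lambda>i. \<mu> (binaryset A B i)) sums (\<mu> A + \<mu> B)"
    by (rule binaryset_sums) (rule vector_measure_empty[OF \<mu>])
  ultimately show ?thesis
    by (simp add: UN_binaryset_eq sums_unique2)
qed

lemma vector_measure_finite_set:
  fixes \<mu> :: "'g::t1_space set \<Rightarrow> 'a::real_normed_vector"
  assumes \<mu>: "vector_measure \<mu>" and "finite F"
  shows "\<mu> F = (\<Sum>x\<in>F. \<mu> {x})"
  using \<open>finite F\<close>
proof induction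
  case empty
  show ?case by (simp add: vector_measure_empty[OF \<mu>])
next
  case (insert x F)
  have "F \<in> sets borel"
    using insert by (intro borel_closed finite_imp_closed)
  with insert show ?case
    using vector_measure_Un[OF \<mu>, of "{x}" F] by simp
qed

text \<open>Countable additivity is regrouping of an unconditional sum along the fibres of the disjoint
  union. For regularity, \<open>U = E\<close> is open, and \<open>K\<close> is a finite part of \<open>E\<close> with a small tail.\<close>

lemma summable_density_bounded_regular:
  fixes f :: "'g::topological_space \<Rightarrow> 'b::banach"
  assumes f: "(\<lambda>x. norm (f x)) summable_on UNIV" and discrete: "\<And>S :: 'g set. open S"
  shows "(\<lambda>E\<in>sets borel. infsum f E) \<in> bounded_regular_measures"
proof -
  have abs_on: "(\<lambda>x. norm (f x)) summable_on B" for B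
    using f by (rule summable_on_subset_banach) simp
  have sum_on: "f summable_on B" for B
    by (rule abs_summable_summable[OF abs_on])
  have bor: "E \<in> sets borel" for E :: "'g set"
    by (rule borel_open[OF discrete])
  let ?\<mu> = "\<lambda>E\<in>sets borel. infsum f E"
  have "vector_measure ?\<mu>"
    unfolding vector_measure_def
  proof (intro conjI allI impI)
    fix E :: "nat \<Rightarrow> 'g set" assume disj: "disjoint_family E"
    have "i = j" if "x \<in> E i" "x \<in> E j" for x i j
      using disj that unfolding disjoint_family_on_def by blast
    then have "inj_on snd (Sigma UNIV E)"
      by (auto simp: inj_on_def)
    moreover have "snd ` Sigma UNIV E = (\<Union>i. E i)"
      by (auto simp: image_iff)
    ultimately have "bij_betw snd (Sigma UNIV E) (\<Union>i. E i)"
      by (simp add: bij_betw_def)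
    then have "((\<lambda>p. f (snd p)) has_sum infsum f (\<Union>i. E i)) (Sigma UNIV E)"
      by (rule has_sum_reindex_bij_betw[THEN iffD2]) (rule has_sum_infsum[OF sum_on])
    then have "((\<lambda>i. infsum f (E i)) has_sum infsum f (\<Union>i. E i)) UNIV"
      by (rule has_sum_SigmaD) (simp add: sum_on)
    then show "(\<lambda>i. ?\<mu> (E i)) sums ?\<mu> (\<Union>i. E i)"
      by (simp add: bor has_sum_imp_sums)
  qed simp
  moreover have "regular_measure ?\<mu>"
    unfolding regular_measure_def
  proof (intro ballI allI impI)
    fix E :: "'g set" and \<epsilon> :: real assume "0 < \<epsilon>"
    then obtain K where K: "finite K" "K \<subseteq> E" "infsum (\<lambda>x. norm (f x)) (E - K) < \<epsilon>"
      using abs_summable_finite_tail[OF abs_on] by blast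
    have "norm (?\<mu> F) < \<epsilon>" if "F \<subseteq> E - K" for F
    proof -
      have "norm (infsum f F) \<le> infsum (\<lambda>x. norm (f x)) F"
        by (rule norm_infsum_bound[OF abs_on])
      also have "\<dots> \<le> infsum (\<lambda>x. norm (f x)) (E - K)"
        by (rule infsum_mono2[OF abs_on abs_on that]) simp
      finally show ?thesis using K(3) by (simp add: bor)
    qed
    then show "\<exists>K U. compact K \<and> open U \<and> K \<subseteq> E \<and> E \<subseteq> U \<and>
        (\<forall>F\<in>sets borel. F \<subseteq> U - K \<longrightarrow> norm (?\<mu> F) < \<epsilon>)"
      using K by (intro exI[of _ K] exI[of _ E]) (simp add: finite_imp_compact discrete)
  qed
  moreover have "total_variation ?\<mu> UNIV < \<infinity>"
  proof -
    have "total_variation ?\<mu> UNIV \<le> ennreal (infsum (\<lambda>x. norm (f x)) UNIV)"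
      unfolding total_variation_def
    proof (rule SUP_least, clarify)
      fix P :: "'g set set"
      assume P: "finite P" "partition_on UNIV P"
      have "(\<Sum>F\<in>P. norm (?\<mu> F)) \<le> (\<Sum>F\<in>P. infsum (\<lambda>x. norm (f x)) F)"
        by (intro sum_mono) (simp add: bor norm_infsum_bound[OF abs_on])
      also have "\<dots> = infsum (\<lambda>x. norm (f x)) (\<Union>F\<in>P. F)"
        using P abs_on by (intro sum_infsum) (auto simp: partition_on_def disjoint_def)
      also have "(\<Union>F\<in>P. F) = UNIV"
        using P by (auto simp: partition_on_def)
      finally show "(\<Sum>F\<in>P. ennreal (norm (?\<mu> F))) \<le> ennreal (infsum (\<lambda>x. norm (f x)) UNIV)"
        by (simp add: ennreal_leI sum_ennreal)
    qed
    also have "\<dots> < \<infinity>" by simp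
    finally show ?thesis .
  qed
  ultimately show ?thesis
    unfolding bounded_regular_measures_def by simp
qed

text \<open>A finite set of points, split into singletons and completed by its complement, is one of the
  partitions over which the total variation is taken.\<close>

lemma bounded_measure_atoms_abs_summable:
  fixes \<mu> :: "'g::t1_space set \<Rightarrow> 'a::real_normed_vector"
  assumes "total_variation \<mu> UNIV < \<infinity>"
  shows "(\<lambda>x. norm (\<mu> {x})) summable_on UNIV"
proof -
  obtain B where B: "total_variation \<mu> UNIV = ennreal B" "0 \<le> B"
    using assms by (cases "total_variation \<mu> UNIV") auto
  have "(\<Sum>x\<in>F. norm (\<mu> {x})) \<le> B" if F: "finite F" for F
  proof -
    \<comment> \<open>If the complement is empty it is left out, as a partition has no empty members.\<close>
    define P where "P = (\<lambda>x. {x}) ` F \<union> ({- F} - {{}})"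
    have "- F \<in> sets borel"
      using F by (intro borel_open open_Compl finite_imp_closed)
    then have P: "finite P" "P \<subseteq> sets borel" "partition_on UNIV P"
      using F by (auto simp: P_def partition_on_def disjoint_def)
    have "ennreal (\<Sum>x\<in>F. norm (\<mu> {x})) = (\<Sum>S\<in>(\<lambda>x. {x}) ` F. ennreal (norm (\<mu> S)))"
      by (simp add: sum.reindex sum_ennreal)
    also have "\<dots> \<le> (\<Sum>S\<in>P. ennreal (norm (\<mu> S)))"
      using P(1) by (intro sum_mono2) (auto simp: P_def)
    also have "\<dots> \<le> total_variation \<mu> UNIV"
      unfolding total_variation_def using P by (intro SUP_upper) auto
    finally show ?thesis
      using B by simp
  qed
  then show ?thesis
    unfolding abs_summable_iff_bdd_above by (auto simp: bdd_above_def)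
qed

text \<open>Let \<open>K \<subseteq> E\<close> be the finite (because compact) set that regularity provides for \<open>\<epsilon>\<close>. A finite \<open>F\<close>
  between \<open>K\<close> and \<open>E\<close> leaves a remainder \<open>E - F\<close> that avoids \<open>K\<close> and so has value below \<open>\<epsilon>\<close>.\<close>

lemma regular_measure_has_sum_atoms:
  fixes \<mu> :: "'g::t2_space set \<Rightarrow> 'a::real_normed_vector"
  assumes \<mu>: "vector_measure \<mu>" "regular_measure \<mu>"
    and discrete: "(euclidean :: 'g topology) = discrete_topology UNIV"
  shows "((\<lambda>x. \<mu> {x}) has_sum \<mu> E) E"
proof -
  have bor: "A \<in> sets borel" for A :: "'g set"
    using discrete by (intro borel_open) (simp add: open_openin)
  show ?thesis
    unfolding has_sum_def tendsto_iff eventually_finite_subsets_at_top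
  proof (intro allI impI)
    fix \<epsilon> :: real assume "0 < \<epsilon>"
    then obtain K U where KU: "compact K" "K \<subseteq> E" "E \<subseteq> U"
      and small: "\<And>F. F \<subseteq> U - K \<Longrightarrow> norm (\<mu> F) < \<epsilon>"
      using \<mu>(2) bor unfolding regular_measure_def by metis
    have "finite K"
      using \<open>compact K\<close> discrete compactin_discrete_topology[of UNIV K]
      by (simp flip: compactin_euclidean_iff)
    moreover have "dist (\<Sum>x\<in>F. \<mu> {x}) (\<mu> E) < \<epsilon>" if F: "finite F" "K \<subseteq> F" "F \<subseteq> E" for F
    proof -
      have "\<mu> E = \<mu> F + \<mu> (E - F)"
        using vector_measure_Un[OF \<mu>(1) bor bor, of F "E - F"] F by (simp add: Un_absorb1)
      moreover have "norm (\<mu> (E - F)) < \<epsilon>"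
        using F KU by (intro small) auto
      ultimately show ?thesis
        using vector_measure_finite_set[OF \<mu>(1) F(1)] by (simp add: dist_norm)
    qed
    ultimately show "\<exists>X. finite X \<and> X \<subseteq> E \<and>
        (\<forall>Y. finite Y \<and> X \<subseteq> Y \<and> Y \<subseteq> E \<longrightarrow> dist (\<Sum>x\<in>Y. \<mu> {x}) (\<mu> E) < \<epsilon>)"
      using KU(2) by blast
  qed
qed

lemma bounded_regular_measures_discrete:
  fixes c :: real
  assumes discrete: "(euclidean :: 'g::t2_space topology) = discrete_topology UNIV" and c: "0 < c"
  shows "(bounded_regular_measures :: ('g set \<Rightarrow> 'b::banach) set)
    = L1_to_measure (weighted_count c) ` L1 (weighted_count c)"
proof (intro subset_antisym subsetI)
  fix \<mu> :: "'g set \<Rightarrow> 'b"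
  assume "\<mu> \<in> bounded_regular_measures"
  then have \<mu>: "vector_measure \<mu>" "regular_measure \<mu>" "total_variation \<mu> UNIV < \<infinity>"
    by (auto simp: bounded_regular_measures_def)
  define f where "f x = (1 / c) *\<^sub>R \<mu> {x}" for x
  have f: "(\<lambda>x. norm (f x)) summable_on UNIV"
    using bounded_measure_atoms_abs_summable[OF \<mu>(3)] c
    by (simp add: f_def summable_on_cmult_right divide_inverse)
  have "c *\<^sub>R infsum f E = \<mu> E" for E
    using infsumI[OF regular_measure_has_sum_atoms[OF \<mu>(1,2) discrete, of E]] c
    unfolding f_def infsum_scaleR_right by simp
  then have "L1_to_measure (weighted_count c) f = restrict \<mu> (sets borel)"
    by (simp add: L1_to_measure_weighted_count[OF f c])
  also have "\<dots> = \<mu>"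
    using \<mu>(1) by (simp add: vector_measure_def extensional_restrict)
  finally show "\<mu> \<in> L1_to_measure (weighted_count c) ` L1 (weighted_count c)"
    using f by (auto simp: L1_weighted_count[OF c])
next
  fix \<mu> :: "'g set \<Rightarrow> 'b"
  assume "\<mu> \<in> L1_to_measure (weighted_count c) ` L1 (weighted_count c)"
  then obtain f :: "'g \<Rightarrow> 'b" where f: "(\<lambda>x. norm (f x)) summable_on UNIV"
    and \<mu>: "\<mu> = L1_to_measure (weighted_count c) f"
    by (auto simp: L1_weighted_count[OF c])
  have "\<mu> = (\<lambda>E\<in>sets borel. infsum (\<lambda>x. c *\<^sub>R f x) E)"
    unfolding \<mu> L1_to_measure_weighted_count[OF f c] by (simp add: infsum_scaleR_right)
  also have "\<dots> \<in> bounded_regular_measures"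
    using f discrete by (intro summable_density_bounded_regular)
      (auto simp: open_openin summable_on_cmult_right)
  finally show "\<mu> \<in> bounded_regular_measures" .
qed

theorem lemma2p5:
  fixes haar :: "'g::{topological_group_add, t2_space} measure"
  assumes "locally_compact_space (euclidean :: 'g topology)"
    and "left_haar_measure haar"
    and "dual_banach_algebra TYPE('a::{complex_banach_algebra, comm_ring_1}) TYPE('e::complex_banach)"
  shows "(bounded_regular_measures :: ('g set \<Rightarrow> 'a) set) = L1_to_measure haar ` L1 haar \<longleftrightarrow>
    (euclidean :: 'g topology) = discrete_topology UNIV"
proof
  assume "(bounded_regular_measures :: ('g set \<Rightarrow> 'a) set) = L1_to_measure haar ` L1 haar"
  then obtain f where "point_mass (0 :: 'g) (1 :: 'a) = L1_to_measure haar f"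
    using point_mass_bounded_regular[of "0 :: 'g" "1 :: 'a"] by auto
  moreover have "sets haar = sets borel"
    by (rule left_haar_measureD(1)[OF assms(2)])
  ultimately have "emeasure haar {0} \<noteq> 0"
    by (intro singleton_not_null_if_point_mass_has_density[where a = "1 :: 'a"]) auto
  then show "(euclidean :: 'g topology) = discrete_topology UNIV"
    by (rule discrete_if_haar_singleton_not_null[OF assms(2)])
next
  assume discrete: "(euclidean :: 'g topology) = discrete_topology UNIV"
  obtain c where "0 < c" "haar = weighted_count c"
    by (rule haar_discrete[OF assms(2) discrete])
  then show "(bounded_regular_measures :: ('g set \<Rightarrow> 'a) set) = L1_to_measure haar ` L1 haar"
    using bounded_regular_measures_discrete[OF discrete] by simp
qed

end
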